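(* Let $q\in(0,1)$. For every $\lambda > 1$, there exists $f\in C[0, 1]$ such that $$M(r;D_{\infty,q}f)\geqslant C r^{-\lambda}(-r;q)_{\infty}, \quad r \to \infty,$$ that is, there is a constant $C>0$ (independent of $r$) such that the inequality holds for all sufficiently large $r$.
   Context: For $a\in\mathbb{C}$ and $0<q<1$, the $q$-Pochhammer symbols are $(a;q)_0=1$, $(a;q)_n=\prod_{j=0}^{n-1}(1-aq^j)$, $(a;q)_\infty=\prod_{j=0}^{\infty}(1-aq^j)$. The limit $q$-Durrmeyer operator is defined for $f\in C[0,1]$ by $(D_{\infty,q}f)(x)=\sum_{k=0}^{\infty} A_{\infty k}(f)\, p_{\infty k}(q;x)$ for $x\in[0,1)$ and $(D_{\infty,q}f)(1)=f(1)$, where $p_{\infty k}(q;x)=\frac{(x;q)_\infty\, x^k}{(q;q)_k}$ and $A_{\infty k}(f)=\frac{q^{-k}}{1-q}\int_0^1 f(t)\,p_{\infty k}(q;qt)\,d_qt$. Here the $q$-integral is $\int_0^a h(t)\,d_qt=(1-q)a\sum_{j=0}^\infty q^j h(aq^j)$. Equivalently, $A_{\infty k}(f)=\frac{(q;q)_\infty}{(q;q)_k}\sum_{j=0}^\infty \frac{f(q^j)q^{(k+1)j}}{(q;q)_j}$. The function $D_{\infty,q}f$ extends (uniquely) from $[0,1]$ to an entire function, still denoted $D_{\infty,q}f$. For a function $h$ analytic in the closed disc $\Delta_r=\{z\in\mathbb{C}:|z|\leqslant r\}$, $M(r;h)=\max_{z\in\Delta_r}|h(z)|$. *)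

theory Defs
  imports "HOL-Complex_Analysis.Complex_Analysis"
begin

definition qpoch :: "'a::real_normed_field \<Rightarrow> 'a \<Rightarrow> nat \<Rightarrow> 'a" where
  "qpoch a q n = (\<Prod>j<n. 1 - a * q ^ j)"

definition qpoch_inf :: "'a::real_normed_field \<Rightarrow> 'a \<Rightarrow> 'a" where
  "qpoch_inf a q = (\<Prod>j. 1 - a * q ^ j)"

definition q_integral :: "real \<Rightarrow> real \<Rightarrow> (real \<Rightarrow> real) \<Rightarrow> real" where
  "q_integral q a h = (1 - q) * a * (\<Sum>j. q ^ j * h (a * q ^ j))"

definition p_inf :: "real \<Rightarrow> nat \<Rightarrow> real \<Rightarrow> real" where
  "p_inf q k x = qpoch_inf x q * x ^ k / qpoch q q k"

definition A_inf :: "real \<Rightarrow> nat \<Rightarrow> (real \<Rightarrow> real) \<Rightarrow> real" where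
  "A_inf q k f = q powi (- int k) / (1 - q) * q_integral q 1 (\<lambda>t. f t * p_inf q k (q * t))"

text \<open>The limit \<open>q\<close>-Durrmeyer operator; only the values at \<open>x \<in> {0..1}\<close> are meaningful.\<close>

definition limit_q_Durrmeyer :: "real \<Rightarrow> (real \<Rightarrow> real) \<Rightarrow> real \<Rightarrow> real" where
  "limit_q_Durrmeyer q f x =
     (if x = 1 then f 1 else (\<Sum>k. A_inf q k f * p_inf q k x))"

text \<open>The supremum is attained, hence is the maximum, whenever \<open>h\<close> is continuous
  on the closed disc and \<open>r \<ge> 0\<close>.\<close>

definition max_modulus :: "real \<Rightarrow> (complex \<Rightarrow> complex) \<Rightarrow> real" where
  "max_modulus r h = (SUP z\<in>cball 0 r. norm (h z))"

end

theory Submission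
  imports Defs "HOL-Real_Asymp.Real_Asymp"
begin

text \<open>Take \<open>0 < \<mu> < 1\<close> with \<open>1 + \<mu> \<le> \<lambda>\<close>, put \<open>\<alpha> = q\<^bsup>1 + \<mu>\<^esup>\<close> and
  \<open>f t = (q;q)\<^sub>\<infinity> t\<^sup>\<mu> / (q t;q)\<^sub>\<infinity>\<close>. Then \<open>A\<^sub>k(f) / (q;q)\<^sub>k = H(q\<^sup>k)\<close> with
  \<open>H u = E u / (1 - \<alpha> u)\<close>, where \<open>E u = (q u;q)\<^sub>\<infinity>\<^sup>2 / (q;q)\<^sub>\<infinity>\<close> is entire. If \<open>h\<^sub>m\<close> are the Taylor
  coefficients of \<open>H\<close>, exchanging summations gives
  \<open>D f z = (z;q)\<^sub>\<infinity> (\<Sum>m. h\<^sub>m / (1 - z q\<^sup>m))\<close>, which is entire. At \<open>z = -r\<close> the leading term of the sum,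
  \<open>H(1/q) / r\<close>, vanishes because \<open>E(1/q) = 0\<close>, and \<open>h\<^sub>m\<close> equals \<open>E(1/\<alpha>) \<alpha>\<^sup>m\<close> up to a rapidly decaying
  error. As \<open>E(1/\<alpha>) \<noteq> 0\<close>, the sum has exact order \<open>r\<^bsup>-1-\<mu>\<^esup>\<close>.\<close>

section \<open>The $q$-Pochhammer symbol\<close>

lemma convergent_prod_qpoch:
  fixes a q :: "'a::{real_normed_field,banach}"
  assumes "norm q < 1"
  shows "convergent_prod (\<lambda>j. 1 - a * q ^ j)"
proof (rule abs_convergent_prod_imp_convergent_prod, rule summable_imp_abs_convergent_prod)
  show "summable (\<lambda>j. norm (1 - a * q ^ j - 1))"
    using assms by (auto simp: norm_mult norm_power intro!: summable_mult summable_geometric)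
qed

lemma qpoch_tendsto:
  fixes a q :: "'a::{real_normed_field,banach}"
  assumes "norm q < 1"
  shows "(\<lambda>n. qpoch a q n) \<longlonglongrightarrow> qpoch_inf a q"
  \<comment> \<open>The limit of an infinite product is taken over indices \<open>j \<le> n\<close>,
    whereas \<open>qpoch\<close> multiplies over \<open>j < n\<close>; the shift does not affect the
    limit.\<close>
  using convergent_prod_LIMSEQ[OF convergent_prod_qpoch[OF assms, of a]]
  by (subst (asm) LIMSEQ_lessThan_iff_atMost [symmetric]) (simp add: qpoch_def qpoch_inf_def)

lemma qpoch_inf_nonzero:
  fixes a q :: "'a::{real_normed_field,banach}"
  assumes "norm q < 1" "\<And>j. a * q ^ j \<noteq> 1"
  shows "qpoch_inf a q \<noteq> 0"
  unfolding qpoch_inf_def using assms convergent_prod_qpoch[OF assms(1), of a]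
  by (intro prodinf_nonzero) (auto simp: right_minus_eq)

lemma qpoch_add: "qpoch a q (m + n) = qpoch a q m * qpoch (a * q ^ m) q n"
  by (induction n) (auto simp: qpoch_def power_add mult_ac)

lemma qpoch_Suc: "qpoch a q (Suc n) = qpoch a q n * (1 - a * q ^ n)"
  by (simp add: qpoch_def)

lemma qpoch_inf_split:
  fixes a q :: "'a::{real_normed_field,banach}"
  assumes "norm q < 1"
  shows "qpoch_inf a q = qpoch a q n * qpoch_inf (a * q ^ n) q"
proof (rule LIMSEQ_unique)
  show "(\<lambda>m. qpoch a q (m + n)) \<longlonglongrightarrow> qpoch_inf a q"
    using qpoch_tendsto[OF assms] by (rule LIMSEQ_ignore_initial_segment)
  show "(\<lambda>m. qpoch a q (m + n)) \<longlonglongrightarrow> qpoch a q n * qpoch_inf (a * q ^ n) q"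
    unfolding qpoch_add add.commute[of _ n] by (intro tendsto_intros qpoch_tendsto assms)
qed

lemma qpoch_of_real: "qpoch (of_real a) (of_real q) n = of_real (qpoch a q n)"
  by (simp add: qpoch_def)

lemma qpoch_inf_of_real:
  assumes "\<bar>q\<bar> < 1"
  shows "qpoch_inf (of_real a) (of_real q) = (of_real (qpoch_inf a q) :: 'a::{real_normed_field,banach})"
proof (rule LIMSEQ_unique)
  show "qpoch (of_real a :: 'a) (of_real q) \<longlonglongrightarrow> qpoch_inf (of_real a) (of_real q)"
    using assms by (intro qpoch_tendsto) auto
  show "qpoch (of_real a :: 'a) (of_real q) \<longlonglongrightarrow> of_real (qpoch_inf a q)"
    unfolding qpoch_of_real using assms by (intro tendsto_of_real qpoch_tendsto) auto
qed

section \<open>Bounds by the real symbol with negative argument\<close>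

lemma norm_qpoch_le:
  assumes "norm a \<le> b"
  shows "norm (qpoch a q n) \<le> qpoch (- b) (norm q) n"
  unfolding qpoch_def prod_norm[symmetric]
proof (intro prod_mono conjI norm_ge_zero)
  fix j
  have "norm (1 - a * q ^ j) \<le> norm (1 :: 'a) + norm (a * q ^ j)"
    by (rule norm_triangle_ineq4)
  also have "norm (a * q ^ j) \<le> b * norm q ^ j"
    using assms by (simp add: norm_mult norm_power mult_right_mono)
  finally show "norm (1 - a * q ^ j) \<le> 1 - - b * norm q ^ j" by simp
qed

lemma norm_qpoch_inf_le:
  fixes a q :: "'a::{real_normed_field,banach}"
  assumes "norm q < 1" "norm a \<le> b"
  shows "norm (qpoch_inf a q) \<le> qpoch_inf (- b) (norm q)"
proof (rule LIMSEQ_le)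
  show "(\<lambda>n. norm (qpoch a q n)) \<longlonglongrightarrow> norm (qpoch_inf a q)"
    using assms by (intro tendsto_norm qpoch_tendsto)
  show "qpoch (- b) (norm q) \<longlonglongrightarrow> qpoch_inf (- b) (norm q)"
    using assms by (intro qpoch_tendsto) auto
qed (use norm_qpoch_le[OF assms(2)] in auto)

lemma qpoch_inf_minus_pos:
  fixes b q :: real
  assumes "0 \<le> q" "q < 1" "b \<ge> 0"
  shows "qpoch_inf (- b) q > 0"
  unfolding qpoch_inf_def using assms convergent_prod_qpoch[of q "- b"]
  by (intro less_0_prodinf) (auto simp: add_pos_nonneg)

section \<open>Analyticity in the first argument\<close>

lemma holomorphic_qpoch [holomorphic_intros]:
  "f holomorphic_on A \<Longrightarrow> (\<lambda>z. qpoch (f z) q n) holomorphic_on A"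
  unfolding qpoch_def by (intro holomorphic_intros)

lemma holomorphic_qpoch_inf_UNIV:
  assumes "norm q < 1"
  shows "(\<lambda>z::complex. qpoch_inf z q) holomorphic_on UNIV"
proof (rule holomorphic_uniform_sequence[OF open_UNIV])
  show "(\<lambda>z. qpoch z q n) holomorphic_on UNIV" for n
    by (intro holomorphic_intros)
next
  fix z :: complex
  have "uniformly_convergent_on (cball z 1) (\<lambda>N z. \<Prod>n<N. 1 + - (z * q ^ n))"
  proof (rule uniformly_convergent_on_prod)
    show "uniformly_convergent_on (cball z 1) (\<lambda>N z. \<Sum>n<N. norm (- (z * q ^ n)))"
    proof (rule Weierstrass_m_test')
      show "norm (norm (- (w * q ^ n))) \<le> (norm z + 1) * norm q ^ n" if "w \<in> cball z 1" for n w
      proof -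
        have "norm w \<le> norm z + 1"
          using that norm_triangle_sub[of w z] by (simp add: dist_norm norm_minus_commute)
        thus ?thesis by (simp add: norm_mult norm_power mult_right_mono)
      qed
      show "summable (\<lambda>n. (norm z + 1) * norm q ^ n)"
        using assms by (intro summable_mult summable_geometric) auto
    qed
  qed (auto intro!: continuous_intros)
  then obtain g where g: "uniform_limit (cball z 1) (\<lambda>N z. qpoch z q N) g sequentially"
    by (auto simp: uniformly_convergent_on_def qpoch_def)
  have "g w = qpoch_inf w q" if "w \<in> cball z 1" for w
    using tendsto_uniform_limitI[OF g that] qpoch_tendsto[OF assms, of w] LIMSEQ_unique by blast
  hence "uniform_limit (cball z 1) (\<lambda>N z. qpoch z q N) (\<lambda>z. qpoch_inf z q) sequentially"
    by (intro uniform_limit_cong[THEN iffD1, OF _ _ g] always_eventually) auto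
  thus "\<exists>d>0. cball z d \<subseteq> UNIV \<and>
          uniform_limit (cball z d) (\<lambda>n z. qpoch z q n) (\<lambda>z. qpoch_inf z q) sequentially"
    by (intro exI[of _ 1]) auto
qed

lemma holomorphic_qpoch_inf [holomorphic_intros]:
  assumes "norm q < 1" "f holomorphic_on A"
  shows "(\<lambda>z. qpoch_inf (f z) q) holomorphic_on A"
  using holomorphic_on_compose_gen[OF assms(2) holomorphic_qpoch_inf_UNIV[OF assms(1)]]
  by (auto simp: o_def)

text \<open>Restrict the entire complex function to the real axis and take real parts.\<close>

lemma continuous_on_qpoch_inf:
  fixes q :: real
  assumes "\<bar>q\<bar> < 1"
  shows "continuous_on A (\<lambda>x. qpoch_inf x q)"
proof -
  have "continuous_on UNIV (\<lambda>z::complex. qpoch_inf z (of_real q))"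
    using assms by (intro holomorphic_on_imp_continuous_on holomorphic_qpoch_inf_UNIV) auto
  hence "continuous_on A (\<lambda>x. qpoch_inf (complex_of_real x) (of_real q))"
    by (rule continuous_on_compose2) (auto intro!: continuous_intros)
  hence "continuous_on A (\<lambda>x. Re (qpoch_inf (complex_of_real x) (of_real q)))"
    by (intro continuous_intros)
  thus ?thesis using assms by (simp add: qpoch_inf_of_real)
qed

text \<open>The infinite product without its factor of index \<open>m\<close>. Skipping the factor
  rather than dividing by it keeps the function entire, also where
  \<open>a * q ^ m = 1\<close>.\<close>

definition qpoch_omit :: "'a::real_normed_field \<Rightarrow> 'a \<Rightarrow> nat \<Rightarrow> 'a" where
  "qpoch_omit a q m = qpoch a q m * qpoch_inf (a * q ^ Suc m) q"

lemma qpoch_omit_mult: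
  fixes a q :: "'a::{real_normed_field,banach}"
  assumes "norm q < 1"
  shows "qpoch_omit a q m * (1 - a * q ^ m) = qpoch_inf a q"
  using qpoch_inf_split[OF assms, of a "Suc m"]
  by (simp add: qpoch_omit_def qpoch_Suc mult_ac)

lemma holomorphic_qpoch_omit [holomorphic_intros]:
  "norm q < 1 \<Longrightarrow> (\<lambda>z. qpoch_omit z q m) holomorphic_on A"
  unfolding qpoch_omit_def by (intro holomorphic_intros)

text \<open>Every factor \<open>1 + b * norm q ^ j\<close> of the majorant is at least 1, so
  restoring the omitted one only enlarges it. The bound is thus free of \<open>m\<close>, as the
  Weierstrass test for \<open>F\<close> needs.\<close>

lemma norm_qpoch_omit_le:
  fixes a q :: "'a::{real_normed_field,banach}"
  assumes "norm q < 1" "norm a \<le> b"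
  shows "norm (qpoch_omit a q m) \<le> qpoch_inf (- b) (norm q)"
proof -
  have b: "b \<ge> 0" using norm_ge_zero[of a] assms(2) by linarith
  have 0: "0 \<le> qpoch (- b) (norm q) m"
    using order.trans[OF norm_ge_zero norm_qpoch_le[OF assms(2)]] .
  have *: "norm (a * q ^ Suc m) \<le> b * norm q ^ Suc m"
    using assms by (simp only: norm_mult norm_power mult_right_mono zero_le_power norm_ge_zero)
  have "norm (qpoch_omit a q m) = norm (qpoch a q m) * norm (qpoch_inf (a * q ^ Suc m) q)"
    by (simp add: qpoch_omit_def norm_mult)
  also have "\<dots> \<le> qpoch (- b) (norm q) m * qpoch_inf (- (b * norm q ^ Suc m)) (norm q)"
    by (intro mult_mono norm_qpoch_le norm_qpoch_inf_le assms * 0) auto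
  also have "\<dots> \<le> qpoch (- b) (norm q) (Suc m) * qpoch_inf (- (b * norm q ^ Suc m)) (norm q)"
  proof (rule mult_right_mono)
    show "qpoch (- b) (norm q) m \<le> qpoch (- b) (norm q) (Suc m)"
      unfolding qpoch_Suc using b 0 by (intro mult_right_le_one_le | simp add: mult_le_cancel_left1)+
    show "0 \<le> qpoch_inf (- (b * norm q ^ Suc m)) (norm q)"
      using assms b by (intro less_imp_le[OF qpoch_inf_minus_pos] mult_nonneg_nonneg) auto
  qed
  also have "\<dots> = qpoch_inf (- b) (norm q)"
    using qpoch_inf_split[of "norm q" "- b" "Suc m"] assms by simp
  finally show ?thesis .
qed

section \<open>The function of near-maximal growth\<close>

text \<open>\<open>mu > 0\<close> makes \<open>f\<close> continuous at 0. Together the two bounds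
  place \<open>1 / al\<close> strictly between the zeros \<open>1 / q\<close> and
  \<open>1 / q ^ 2\<close> of \<open>E\<close>.\<close>

locale Durrmeyer_example =
  fixes q mu :: real
  assumes q: "0 < q" "q < 1" and mu: "0 < mu" "mu < 1"
begin

abbreviation Q :: complex where "Q \<equiv> of_real q"

definition al :: real where "al = q powr (1 + mu)"

text \<open>At \<open>t = q ^ j\<close> this is \<open>qpoch q q j * q powr (mu * j)\<close>, which turns the series in
  \<open>A_inf\<close> into a geometric one.\<close>

definition f :: "real \<Rightarrow> real" where
  "f t = qpoch_inf q q * t powr mu / qpoch_inf (q * t) q"

definition E :: "complex \<Rightarrow> complex" where
  "E u = qpoch_inf (u * Q) Q ^ 2 / qpoch_inf Q Q"

definition e :: "nat \<Rightarrow> complex" where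
  "e n = (deriv ^^ n) E 0 / fact n"

text \<open>The Taylor coefficients of \<open>E u / (1 - al * u)\<close> at \<open>0\<close>.\<close>

definition h :: "nat \<Rightarrow> complex" where
  "h m = (\<Sum>i\<le>m. e i * of_real al ^ (m - i))"

text \<open>Termwise this is \<open>qpoch_inf z Q * (\<Sum>m. h m / (1 - z * Q ^ m))\<close> with the poles removed.\<close>

definition F :: "complex \<Rightarrow> complex" where
  "F z = (\<Sum>m. h m * qpoch_omit z Q m)"

lemma norm_Q: "norm Q < 1"
  using q by simp

lemma al_eq: "al = q * q powr mu"
  using q by (simp add: al_def powr_add)

lemma q_mu: "0 < q powr mu" "q powr mu < 1"
  using q mu powr_less_mono'[of q 0 mu] by auto

lemma al: "0 < al" "al < q" "al < 1"
  using q q_mu by (auto simp: al_eq intro: less_trans[of _ q])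

lemma qpoch_pos: "qpoch q q n > 0"
  using q unfolding qpoch_def
  by (intro prod_pos) (auto simp: power_Suc_less_one simp flip: power_Suc)

lemma qpoch_inf_pos:
  assumes "0 \<le> t" "t \<le> 1"
  shows "qpoch_inf (q * t) q > 0"
  unfolding qpoch_inf_def
proof (rule less_0_prodinf)
  show "convergent_prod (\<lambda>j. 1 - q * t * q ^ j)"
    using q by (intro convergent_prod_qpoch) auto
  show "0 < 1 - q * t * q ^ j" for j
  proof -
    have "q * t * q ^ j \<le> q * 1 * 1"
      using q assms by (intro mult_mono power_le_one) auto
    also have "q * 1 * 1 < 1" using q by simp
    finally show ?thesis by simp
  qed
qed

lemma qpoch_inf_q_pos: "qpoch_inf q q > 0"
  using qpoch_inf_pos[of 1] by simp

lemma qpoch_inf_Q: "qpoch_inf Q Q = of_real (qpoch_inf q q)"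
  using q by (intro qpoch_inf_of_real) auto

lemma continuous_f: "continuous_on {0..1} f"
proof -
  have "continuous_on {0..1} (\<lambda>t. qpoch_inf (q * t) q)"
    by (rule continuous_on_compose2[OF continuous_on_qpoch_inf[of q UNIV]])
       (use q in \<open>auto intro!: continuous_intros\<close>)
  moreover have "continuous_on {0..1} (\<lambda>t. t powr mu)"
    using mu by (intro continuous_on_powr' continuous_intros) auto
  ultimately show ?thesis
    unfolding f_def using qpoch_inf_pos
    by (intro continuous_on_divide continuous_on_mult continuous_on_const ballI) force+
qed

section \<open>The coefficients and their interpolation by \<open>E\<close>\<close>

lemma A_inf_f: "A_inf q k f = qpoch_inf q q / qpoch q q k / (1 - al * q ^ k)"
proof -
  \<comment> \<open>The factor \<open>qpoch_inf (q * q ^ j) q\<close> of \<open>p_inf\<close>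
    cancels the denominator of \<open>f\<close>; the remaining powers of \<open>q\<close> combine to
    \<open>q ^ k * (al * q ^ k) ^ j\<close>.\<close>
  have *: "q ^ j * (f (1 * q ^ j) * p_inf q k (q * (1 * q ^ j))) =
             qpoch_inf q q / qpoch q q k * q ^ k * (al * q ^ k) ^ j" for j
  proof -
    have "qpoch_inf (q * q ^ j) q > 0"
      using q by (intro qpoch_inf_pos power_le_one) auto
    moreover have "(q ^ j) powr mu = (q powr mu) ^ j"
      using q by (simp add: powr_powr powr_realpow[symmetric] powr_realpow' mult.commute)
    ultimately show ?thesis
      by (simp add: f_def p_inf_def al_eq power_mult_distrib power_mult[symmetric] mult_ac)
  qed
  have lt: "al * q ^ k < 1"
    using al q mult_left_mono[of "q ^ k" 1 al] power_le_one[of q k] by linarith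
  have "(\<Sum>j. qpoch_inf q q / qpoch q q k * q ^ k * (al * q ^ k) ^ j) =
          qpoch_inf q q / qpoch q q k * q ^ k * (1 / (1 - al * q ^ k))"
    using al q lt by (subst suminf_mult) (auto simp: suminf_geometric)
  moreover have "A_inf q k f = (\<Sum>j. qpoch_inf q q / qpoch q q k * q ^ k * (al * q ^ k) ^ j) / q ^ k"
    using q unfolding A_inf_def q_integral_def * by (simp add: power_int_minus divide_inverse mult_ac)
  ultimately show ?thesis using q by simp
qed

text \<open>Splitting \<open>k\<close> factors off \<open>qpoch_inf q q\<close> yields one
  \<open>qpoch q q k\<close> per factor of the square. One copy belongs to \<open>A_inf\<close>, the
  other to \<open>p_inf\<close>.\<close>

lemma E_at_power: "E (Q ^ k) = of_real (qpoch_inf q q / qpoch q q k ^ 2)"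
proof -
  have "qpoch_inf (Q ^ k * Q) Q = of_real (qpoch_inf (q * q ^ k) q)"
    using q by (subst qpoch_inf_of_real[symmetric]) (auto simp: mult.commute)
  also have "qpoch_inf (q * q ^ k) q = qpoch_inf q q / qpoch q q k"
    using qpoch_inf_split[of q q k] qpoch_pos[of k] q by (simp add: field_simps)
  finally show ?thesis
    using qpoch_inf_q_pos by (simp add: E_def qpoch_inf_Q power2_eq_square)
qed

lemma E_inverse_q: "E (1 / Q) = 0"
  using q norm_Q qpoch_inf_split[of Q 1 1] by (simp add: E_def qpoch_def)

text \<open>A zero would require \<open>q powr (- mu) * q ^ j = 1\<close>; but the left side exceeds
  1 for \<open>j = 0\<close> and is below 1 for \<open>j \<ge> 1\<close>, since
  \<open>q < q powr mu < 1\<close>.\<close>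

lemma E_inverse_al: "E (1 / of_real al) \<noteq> 0"
proof -
  have "q powr (- mu) * q ^ j \<noteq> 1" for j
  proof (cases j)
    case 0
    thus ?thesis using q mu q_mu by (simp add: powr_minus field_simps)
  next
    case (Suc n)
    have "q < q powr mu" using q mu powr_less_mono'[of q mu 1] by simp
    moreover have "q ^ j \<le> q" using q Suc power_decreasing[of 1 j q] by simp
    ultimately show ?thesis using q by (simp add: powr_minus field_simps)
  qed
  moreover have "1 / of_real al * Q = of_real (q powr (- mu))"
    using q by (simp add: al_eq powr_minus field_simps)
  ultimately have "qpoch_inf (1 / of_real al * Q) Q \<noteq> 0"
    using norm_Q by (intro qpoch_inf_nonzero) (auto simp flip: of_real_power of_real_mult)
  thus ?thesis using qpoch_inf_q_pos by (simp add: E_def qpoch_inf_Q)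
qed

lemma holomorphic_E: "E holomorphic_on A"
  unfolding E_def using qpoch_inf_q_pos norm_Q
  by (intro holomorphic_intros) (auto simp: qpoch_inf_Q)

section \<open>Taylor coefficients of \<open>E\<close> and of its quotient by
  \<open>1 - al * u\<close>\<close>

lemma e_sums: "(\<lambda>n. e n * u ^ n) sums E u"
  using holomorphic_power_series[OF holomorphic_E, of u 0 "norm u + 1"]
  by (simp add: e_def)

text \<open>The series also converges at a point of modulus \<open>norm u + 1\<close>, hence
  absolutely at \<open>u\<close>.\<close>

lemma e_summable: "summable (\<lambda>n. norm (e n * u ^ n))"
  by (rule powser_insidea[of _ "of_real (norm u + 1)"])
     (use sums_summable[OF e_sums] in \<open>auto simp del: of_real_add\<close>)

text \<open>Cauchy product of the series of \<open>E\<close> with the geometric series in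
  \<open>al * u\<close>, valid up to the pole \<open>1 / al\<close>.\<close>

lemma h_sums:
  assumes "al * norm u < 1"
  shows "summable (\<lambda>m. norm (h m * u ^ m))" "(\<lambda>m. h m * u ^ m) sums (E u / (1 - of_real al * u))"
proof -
  have eq: "(\<Sum>i\<le>m. (e i * u ^ i) * (of_real al * u) ^ (m - i)) = h m * u ^ m" for m
    unfolding h_def sum_distrib_right
    by (intro sum.cong) (auto simp: power_mult_distrib mult_ac power_add[symmetric])
  have lt: "norm (of_real al * u) < 1"
    using assms al by (simp add: norm_mult)
  have geo: "summable (\<lambda>k. norm ((of_real al * u) ^ k))"
    using lt by (simp add: norm_power summable_geometric)
  have "(\<lambda>m. h m * u ^ m) sums ((\<Sum>i. e i * u ^ i) * (\<Sum>k. (of_real al * u) ^ k))"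
    using Cauchy_product_sums[OF e_summable[of u] geo] by (simp only: eq)
  thus "(\<lambda>m. h m * u ^ m) sums (E u / (1 - of_real al * u))"
    using lt sums_unique[OF e_sums[of u]] by (simp add: suminf_geometric)
  have "summable (\<lambda>k. norm (norm ((of_real al * u) ^ k)))"
    using geo by simp
  hence "summable (\<lambda>m. \<Sum>i\<le>m. norm (e i * u ^ i) * norm ((of_real al * u) ^ (m - i)))"
    using e_summable[of u] by (intro summable_Cauchy_product) auto
  thus "summable (\<lambda>m. norm (h m * u ^ m))"
  proof (rule summable_comparison_test')
    show "norm (norm (h m * u ^ m)) \<le> (\<Sum>i\<le>m. norm (e i * u ^ i) * norm ((of_real al * u) ^ (m - i)))" for m
      unfolding eq[symmetric] norm_mult[symmetric] by (simp add: norm_sum)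
  qed
qed

lemma h_summable: "summable (\<lambda>m. norm (h m))"
  using h_sums(1)[of 1] al by simp

text \<open>\<open>h m\<close> is \<open>al ^ m\<close> times a partial sum of the series for
  \<open>E (1 / al)\<close>, so the error is \<open>al ^ m\<close> times a tail. Comparing that tail
  with the convergent series at \<open>1 / q ^ 3\<close> gains \<open>(q ^ 3 / al) ^ m\<close>. The
  rate \<open>q ^ 3\<close> is chosen to outweigh the factor \<open>q ^ (2 * m)\<close> by which
  \<open>F_lower\<close> divides.\<close>

lemma h_asymp:
  obtains K where "K \<ge> 0" "\<And>m. norm (h m - E (1 / of_real al) * of_real al ^ m) \<le> K * (q ^ 3) ^ m"
proof
  define K where "K = (\<Sum>i. norm (e i * (1 / Q ^ 3) ^ i))"
  show "K \<ge> 0" unfolding K_def by (intro suminf_nonneg e_summable) auto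
  fix m
  have s: "(\<lambda>i. e (i + Suc m) * (1 / of_real al) ^ (i + Suc m)) sums
          (E (1 / of_real al) - (\<Sum>i<Suc m. e i * (1 / of_real al) ^ i))"
    by (rule sums_split_initial_segment[OF e_sums])
  have "of_real al ^ m * (\<Sum>i<Suc m. e i * (1 / of_real al) ^ i) = h m"
    unfolding h_def lessThan_Suc_atMost sum_distrib_left using al
    by (intro sum.cong) (auto simp: power_diff field_simps)
  hence "h m - E (1 / of_real al) * of_real al ^ m =
          - (\<Sum>i. e (i + Suc m) * (1 / of_real al) ^ (i + Suc m)) * of_real al ^ m"
    unfolding sums_unique[OF s, symmetric] by (simp add: algebra_simps)
  hence "norm (h m - E (1 / of_real al) * of_real al ^ m) =
          norm (\<Sum>i. e (i + Suc m) * (1 / of_real al) ^ (i + Suc m)) * al ^ m"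
    using al by (simp add: norm_mult norm_power)
  also have "norm (\<Sum>i. e (i + Suc m) * (1 / of_real al) ^ (i + Suc m)) \<le>
               (\<Sum>i. norm (e (i + Suc m) * (1 / Q ^ 3) ^ (i + Suc m)) * (q ^ 3 / al) ^ m)"
  proof (rule norm_suminf_le)
    show "summable (\<lambda>i. norm (e (i + Suc m) * (1 / Q ^ 3) ^ (i + Suc m)) * (q ^ 3 / al) ^ m)"
      using e_summable by (intro summable_mult2 summable_ignore_initial_segment)
    have "q ^ 3 \<le> q ^ 2" using q by (intro power_decreasing) auto
    also have "q ^ 2 \<le> al" using q mu powr_mono'[of "1 + mu" 2 q] by (simp add: al_def)
    finally have le: "q ^ 3 \<le> al" .
    fix i
    have eq: "(1 / al) ^ (i + Suc m) = (1 / q ^ 3) ^ (i + Suc m) * (q ^ 3 / al) ^ (i + Suc m)"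
      unfolding power_mult_distrib[symmetric] using q by simp
    have "(q ^ 3 / al) ^ (i + Suc m) \<le> (q ^ 3 / al) ^ m"
      using le q al by (intro power_decreasing) auto
    hence "(1 / al) ^ (i + Suc m) \<le> (1 / q ^ 3) ^ (i + Suc m) * (q ^ 3 / al) ^ m"
      unfolding eq using q by (intro mult_left_mono) auto
    hence "norm (e (i + Suc m)) * (1 / al) ^ (i + Suc m) \<le>
             norm (e (i + Suc m)) * ((1 / q ^ 3) ^ (i + Suc m) * (q ^ 3 / al) ^ m)"
      by (intro mult_left_mono) auto
    thus "norm (e (i + Suc m) * (1 / of_real al) ^ (i + Suc m)) \<le>
            norm (e (i + Suc m) * (1 / Q ^ 3) ^ (i + Suc m)) * (q ^ 3 / al) ^ m"
      using q al by (simp add: norm_mult norm_power norm_divide mult_ac)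
  qed
  also have "\<dots> = (\<Sum>i. norm (e (i + Suc m) * (1 / Q ^ 3) ^ (i + Suc m))) * (q ^ 3 / al) ^ m"
    by (rule suminf_mult2[symmetric], rule summable_ignore_initial_segment[OF e_summable])
  also have "(\<Sum>i. norm (e (i + Suc m) * (1 / Q ^ 3) ^ (i + Suc m))) \<le> K"
    unfolding K_def suminf_split_initial_segment[OF e_summable, of _ "Suc m"]
    by (simp add: sum_nonneg)
  finally show "norm (h m - E (1 / of_real al) * of_real al ^ m) \<le> K * (q ^ 3) ^ m"
    using al q by (simp add: power_divide mult_right_mono)
qed

section \<open>The entire extension of the operator's image\<close>

lemma holomorphic_F: "F holomorphic_on UNIV"
proof (rule holomorphic_uniform_sequence[OF open_UNIV])
  show "(\<lambda>z. \<Sum>m<n. h m * qpoch_omit z Q m) holomorphic_on UNIV" for n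
    using norm_Q by (intro holomorphic_intros)
  fix z :: complex
  have "uniform_limit (cball z 1) (\<lambda>n z. \<Sum>m<n. h m * qpoch_omit z Q m) F sequentially"
    unfolding F_def
  proof (rule Weierstrass_m_test)
    \<comment> \<open>On the unit ball around \<open>z\<close> the omitted products share one bound,
      so summability of \<open>norm (h m)\<close> suffices.\<close>
    show "norm (h m * qpoch_omit w Q m) \<le> norm (h m) * qpoch_inf (- (norm z + 1)) (norm Q)"
      if "w \<in> cball z 1" for m w
    proof -
      have "norm w \<le> norm z + 1"
        using that norm_triangle_sub[of w z] by (simp add: dist_norm norm_minus_commute)
      thus ?thesis
        unfolding norm_mult by (intro mult_left_mono norm_qpoch_omit_le norm_Q) auto
    qed
    show "summable (\<lambda>m. norm (h m) * qpoch_inf (- (norm z + 1)) (norm Q))"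
      by (intro summable_mult2 h_summable)
  qed
  thus "\<exists>d>0. cball z d \<subseteq> UNIV \<and>
          uniform_limit (cball z d) (\<lambda>n z. \<Sum>m<n. h m * qpoch_omit z Q m) F sequentially"
    by (intro exI[of _ 1]) auto
qed

lemma F_sums: "(\<lambda>m. h m * qpoch_omit z Q m) sums F z"
proof -
  have "summable (\<lambda>m. h m * qpoch_omit z Q m)"
  proof (rule summable_comparison_test')
    show "summable (\<lambda>m. norm (h m) * qpoch_inf (- norm z) (norm Q))"
      by (intro summable_mult2 h_summable)
    show "norm (h m * qpoch_omit z Q m) \<le> norm (h m) * qpoch_inf (- norm z) (norm Q)" for m
      unfolding norm_mult by (intro mult_left_mono norm_qpoch_omit_le norm_Q) auto
  qed
  thus ?thesis by (simp add: F_def summable_sums)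
qed

text \<open>At \<open>z = 1\<close> the factor of index 0 vanishes, and it is omitted only for
  \<open>m = 0\<close>. The surviving term is \<open>E 0 * qpoch_inf Q Q = 1\<close>.\<close>

lemma F_one: "F 1 = 1"
proof -
  have "h m * qpoch_omit 1 Q m = 0" if "m \<noteq> 0" for m
    using that by (auto simp: qpoch_omit_def qpoch_def intro!: bexI[of _ 0])
  hence "(\<lambda>m. h m * qpoch_omit 1 Q m) sums (h 0 * qpoch_omit 1 Q 0)"
    using sums_finite[of "{0}" "\<lambda>m. h m * qpoch_omit 1 Q m"] by simp
  hence "F 1 = h 0 * qpoch_omit 1 Q 0"
    using F_sums sums_unique2 by blast
  also have "h 0 = 1 / qpoch_inf Q Q"
    using e_sums[of 0] E_at_power[of 0] qpoch_inf_q_pos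
    by (simp add: h_def e_def E_def qpoch_inf_def power2_eq_square)
  finally show ?thesis
    using qpoch_inf_q_pos by (simp add: qpoch_omit_def qpoch_def qpoch_inf_Q)
qed

text \<open>Exchanging the two summations: after \<open>K\<close> terms of each geometric series
  \<open>1 / (1 - x q\<^sup>m)\<close> the remainders add up to \<open>O(\<bar>x\<bar> ^ K)\<close>.\<close>

lemma F_sums_power:
  assumes x: "norm x < 1"
  shows "(\<lambda>k. qpoch_inf x Q * x ^ k * (E (Q ^ k) / (1 - of_real al * Q ^ k))) sums F x"
proof -
  have nz: "1 - x * Q ^ m \<noteq> 0" and bd: "1 - norm x \<le> norm (1 - x * Q ^ m)" for m
  proof -
    have "norm (x * Q ^ m) \<le> norm x * 1"
      unfolding norm_mult using q by (intro mult_left_mono) (auto simp: norm_power power_le_one)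
    thus "1 - norm x \<le> norm (1 - x * Q ^ m)"
      using norm_triangle_ineq2[of 1 "x * Q ^ m"] by simp
    thus "1 - x * Q ^ m \<noteq> 0" using x by auto
  qed
  have "(\<lambda>K. F x - (\<Sum>k<K. qpoch_inf x Q * x ^ k * (E (Q ^ k) / (1 - of_real al * Q ^ k)))) \<longlonglongrightarrow> 0"
  proof (rule Lim_null_comparison, rule always_eventually, rule allI)
    fix K :: nat
    define c where "c = (\<lambda>m. qpoch_inf x Q * (h m * (x * Q ^ m) ^ K / (1 - x * Q ^ m)))"
    have "(\<lambda>m. \<Sum>k<K. qpoch_inf x Q * x ^ k * (h m * (Q ^ k) ^ m)) sums
            (\<Sum>k<K. qpoch_inf x Q * x ^ k * (E (Q ^ k) / (1 - of_real al * Q ^ k)))"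
    proof (intro sums_sum sums_mult h_sums(2))
      fix k
      have "al * norm (Q ^ k) \<le> al * 1"
        using q al by (intro mult_left_mono) (auto simp: norm_power power_le_one)
      thus "al * norm (Q ^ k) < 1" using al by linarith
    qed
    from sums_diff[OF F_sums[of x] this]
    have "(\<lambda>m. h m * qpoch_omit x Q m - (\<Sum>k<K. qpoch_inf x Q * x ^ k * (h m * (Q ^ k) ^ m))) sums
      (F x - (\<Sum>k<K. qpoch_inf x Q * x ^ k * (E (Q ^ k) / (1 - of_real al * Q ^ k))))" .
    \<comment> \<open>\<open>qpoch_omit x Q m\<close> equals
      \<open>qpoch_inf x Q / (1 - x * Q ^ m)\<close>, so subtracting \<open>K\<close> geometric
      terms leaves exactly the remainder \<open>c m\<close>.\<close>
    also have "(\<lambda>m. h m * qpoch_omit x Q m - (\<Sum>k<K. qpoch_inf x Q * x ^ k * (h m * (Q ^ k) ^ m))) = c"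
    proof
      fix m
      have "(\<Sum>k<K. qpoch_inf x Q * x ^ k * (h m * (Q ^ k) ^ m)) =
              qpoch_inf x Q * h m * (\<Sum>k<K. (x * Q ^ m) ^ k)"
        by (simp add: sum_distrib_left power_mult_distrib power_mult[symmetric] mult_ac)
      also have "(\<Sum>k<K. (x * Q ^ m) ^ k) = (1 - (x * Q ^ m) ^ K) / (1 - x * Q ^ m)"
        using nz[of m] by (subst sum_gp_strict) auto
      finally show "h m * qpoch_omit x Q m - (\<Sum>k<K. qpoch_inf x Q * x ^ k * (h m * (Q ^ k) ^ m)) = c m"
        using nz[of m] unfolding c_def qpoch_omit_mult[OF norm_Q, of x m, symmetric]
        by (simp add: divide_simps) (simp add: algebra_simps)
    qed
    finally have c: "c sums (F x - (\<Sum>k<K. qpoch_inf x Q * x ^ k * (E (Q ^ k) / (1 - of_real al * Q ^ k))))" .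
    have "norm (suminf c) \<le> (\<Sum>m. norm (h m) * (norm (qpoch_inf x Q) * norm x ^ K / (1 - norm x)))"
    proof (rule norm_suminf_le)
      show "summable (\<lambda>m. norm (h m) * (norm (qpoch_inf x Q) * norm x ^ K / (1 - norm x)))"
        by (intro summable_mult2 h_summable)
      fix m
      have "norm (x * Q ^ m) \<le> norm x * 1"
        unfolding norm_mult using q by (intro mult_left_mono) (auto simp: norm_power power_le_one)
      hence "norm ((x * Q ^ m) ^ K) / norm (1 - x * Q ^ m) \<le> norm x ^ K / (1 - norm x)"
        unfolding norm_power using x by (intro frac_le power_mono bd) auto
      hence "norm (qpoch_inf x Q) * norm (h m) * (norm ((x * Q ^ m) ^ K) / norm (1 - x * Q ^ m)) \<le>
              norm (qpoch_inf x Q) * norm (h m) * (norm x ^ K / (1 - norm x))"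
        by (intro mult_left_mono) auto
      thus "norm (c m) \<le> norm (h m) * (norm (qpoch_inf x Q) * norm x ^ K / (1 - norm x))"
        by (simp add: c_def norm_mult norm_divide mult_ac)
    qed
    also have "\<dots> = (\<Sum>m. norm (h m)) * (norm (qpoch_inf x Q) * norm x ^ K / (1 - norm x))"
      by (rule suminf_mult2[symmetric]) (rule h_summable)
    finally show "norm (F x - (\<Sum>k<K. qpoch_inf x Q * x ^ k * (E (Q ^ k) / (1 - of_real al * Q ^ k))))
       \<le> (\<Sum>m. norm (h m)) * (norm (qpoch_inf x Q) * norm x ^ K / (1 - norm x))"
      using sums_unique[OF c] by simp
  next
    have "(\<lambda>K. (\<Sum>m. norm (h m)) * (norm (qpoch_inf x Q) * norm x ^ K / (1 - norm x))) \<longlonglongrightarrow>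
            (\<Sum>m. norm (h m)) * (norm (qpoch_inf x Q) * 0 / (1 - norm x))"
      using x by (intro tendsto_intros LIMSEQ_power_zero) auto
    thus "(\<lambda>K. (\<Sum>m. norm (h m)) * (norm (qpoch_inf x Q) * norm x ^ K / (1 - norm x))) \<longlonglongrightarrow> 0"
      by simp
  qed
  from tendsto_diff[OF tendsto_const[of "F x"] this] show ?thesis
    by (simp add: sums_def)
qed

text \<open>For \<open>x < 1\<close> the terms of \<open>F_sums_power\<close> are the real numbers
  \<open>A_inf q k f * p_inf q k x\<close>. The endpoint, where the operator is set to
  \<open>f 1 = 1\<close>, is \<open>F_one\<close>.\<close>

lemma F_eq_Durrmeyer:
  assumes "x \<in> {0..1}"
  shows "F (of_real x) = of_real (limit_q_Durrmeyer q f x)"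
proof (cases "x = 1")
  case True
  thus ?thesis using F_one qpoch_inf_q_pos by (simp add: limit_q_Durrmeyer_def f_def)
next
  case False
  hence x: "0 \<le> x" "x < 1" using assms by auto
  have "qpoch_inf (of_real x) Q * of_real x ^ k * (E (Q ^ k) / (1 - of_real al * Q ^ k)) =
          complex_of_real (A_inf q k f * p_inf q k x)" for k
  proof -
    have "qpoch_inf (of_real x) Q = complex_of_real (qpoch_inf x q)"
      using q by (intro qpoch_inf_of_real) auto
    thus ?thesis
      by (simp add: A_inf_f p_inf_def E_at_power power2_eq_square mult_ac)
  qed
  with F_sums_power[of "of_real x"] x
  have s: "(\<lambda>k. complex_of_real (A_inf q k f * p_inf q k x)) sums F (of_real x)"
    by simp
  have "(\<lambda>k. A_inf q k f * p_inf q k x) sums Re (F (of_real x))"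
    using sums_Re[OF s] by simp
  hence re: "limit_q_Durrmeyer q f x = Re (F (of_real x))"
    using False by (simp add: limit_q_Durrmeyer_def sums_iff)
  have "Im (F (of_real x)) = 0"
    using sums_Im[OF s] by (simp add: sums_iff)
  with re show ?thesis by (simp add: complex_eq_iff)
qed

section \<open>Growth of \<open>F\<close> on the negative real axis\<close>

text \<open>Write \<open>1 / (1 + r q\<^sup>m) = 1 / (r q\<^sup>m) - 1 / (r q\<^sup>m (1 + r q\<^sup>m))\<close>: the first terms sum to a
  multiple of \<open>E (1 / Q) = 0\<close>, so the leading order \<open>1 / r\<close> cancels.\<close>

lemma F_minus:
  assumes r: "r > 0"
  shows "(\<lambda>m. h m / (Q ^ m * (1 + of_real r * Q ^ m))) sums
           (- of_real r * F (- of_real r) / qpoch_inf (- of_real r) Q)"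
proof -
  have nz: "qpoch_inf (- of_real r) Q \<noteq> 0"
    using qpoch_inf_of_real[of q "- r", where 'a = complex] qpoch_inf_minus_pos[of q r] q r by auto
  have nz2: "1 + of_real r * Q ^ m \<noteq> 0" for m
  proof -
    have "1 + r * q ^ m > 0" using q r by (intro add_pos_nonneg) auto
    thus ?thesis
      by (metis of_real_1 of_real_add of_real_eq_0_iff of_real_mult of_real_power less_irrefl)
  qed
  have om: "qpoch_omit (- of_real r) Q m = qpoch_inf (- of_real r) Q / (1 + of_real r * Q ^ m)" for m
    using qpoch_omit_mult[OF norm_Q, of "- of_real r" m] nz2[of m] by (simp add: field_simps)
  \<comment> \<open>As \<open>al < q\<close>, the zero \<open>1 / Q\<close> of \<open>E\<close> lies
    inside the disc of convergence of the \<open>h\<close> series.\<close>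
  have lt: "al * norm (1 / Q) < 1"
    using q al by (simp add: norm_divide)
  have "(\<lambda>m. h m * (1 / Q) ^ m) sums 0"
    using h_sums(2)[OF lt] by (simp add: E_inverse_q)
  from sums_diff[OF this sums_mult[OF F_sums[of "- of_real r"], of "of_real r / qpoch_inf (- of_real r) Q"]]
  have "(\<lambda>m. h m * (1 / Q) ^ m -
     of_real r / qpoch_inf (- of_real r) Q * (h m * qpoch_omit (- of_real r) Q m)) sums
     (- of_real r * F (- of_real r) / qpoch_inf (- of_real r) Q)" by simp
  also have "(\<lambda>m. h m * (1 / Q) ^ m -
     of_real r / qpoch_inf (- of_real r) Q * (h m * qpoch_omit (- of_real r) Q m)) =
     (\<lambda>m. h m / (Q ^ m * (1 + of_real r * Q ^ m)))"
    unfolding om using nz nz2 q by (simp add: field_simps fun_eq_iff)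
  finally show ?thesis .
qed

text \<open>Insert \<open>h_asymp\<close> into \<open>F_minus\<close>. The main part is a positive
  series of size at least a multiple of \<open>r powr (- mu)\<close>; the error is only
  \<open>O(1 / r)\<close>.\<close>

lemma F_lower:
  obtains c K where "c > 0" "K \<ge> 0"
    "\<And>r. r \<ge> 1 \<Longrightarrow> norm (F (- of_real r)) \<ge> qpoch_inf (- r) q / r * (c * r powr (- mu) - K / r)"
proof -
  obtain K where K: "K \<ge> 0" "\<And>m. norm (h m - E (1 / of_real al) * of_real al ^ m) \<le> K * (q ^ 3) ^ m"
    using h_asymp by blast
  define E0 where "E0 = E (1 / of_real al)"
  have E0: "norm E0 > 0" using E_inverse_al by (simp add: E0_def)
  show ?thesis
  proof (rule that[of "norm E0 * (q powr mu / 2)" "K / (1 - q)"])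
    show "norm E0 * (q powr mu / 2) > 0" using E0 q by simp
    show "K / (1 - q) \<ge> 0" using K q by simp
    fix r :: real assume r: "r \<ge> 1"
    have pos: "1 + r * q ^ m \<ge> 1" for m using q r by simp
    \<comment> \<open>\<open>E0 * T\<close> comes from the leading term of \<open>h\<close>, using
      \<open>al / q = q powr mu\<close>; \<open>D\<close> collects the error.\<close>
    define T where "T = (\<lambda>m. (q powr mu) ^ m / (1 + r * q ^ m))"
    define D where "D = (\<lambda>m. (h m - E0 * of_real al ^ m) / (Q ^ m * (1 + of_real r * Q ^ m)))"
    have T0: "T m \<ge> 0" for m using pos[of m] by (simp add: T_def)
    have T: "summable T"
    proof (rule summable_comparison_test')
      show "summable (\<lambda>m. (q powr mu) ^ m)" using q_mu by (intro summable_geometric) auto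
      show "norm (T m) \<le> (q powr mu) ^ m" for m
        using pos[of m] T0[of m] frac_le[of "(q powr mu) ^ m" "(q powr mu) ^ m" 1 "1 + r * q ^ m"]
        by (simp add: T_def)
    qed
    have Dle: "norm (D m) \<le> K / r * q ^ m" for m
    proof -
      have nrm: "norm (1 + of_real r * Q ^ m) = 1 + r * q ^ m"
        using pos[of m] by (metis abs_of_nonneg norm_of_real of_real_1 of_real_add of_real_mult
            of_real_power order.trans zero_le_one)
      have "norm (D m) = norm (h m - E0 * of_real al ^ m) / (q ^ m * (1 + r * q ^ m))"
        using q by (simp add: D_def norm_divide norm_mult nrm norm_power)
      \<comment> \<open>Dropping the 1 in \<open>1 + r * q ^ m\<close> extracts the factor
        \<open>1 / r\<close> and leaves a convergent geometric series.\<close>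
      also have "\<dots> \<le> K * (q ^ 3) ^ m / (q ^ m * (r * q ^ m))"
        using K q r by (intro frac_le) (auto simp: E0_def)
      also have "\<dots> = K / r * q ^ m"
        using q r by (simp add: field_simps power_mult[symmetric] power_add[symmetric] mult_2_right numeral_3_eq_3)
      finally show ?thesis .
    qed
    have geo: "summable (\<lambda>m. K / r * q ^ m)"
      using q by (intro summable_mult summable_geometric) auto
    have D: "summable D"
      by (rule summable_comparison_test'[OF geo Dle])
    have "norm (suminf D) \<le> (\<Sum>m. K / r * q ^ m)"
      by (rule norm_suminf_le[OF Dle geo])
    also have "\<dots> = K / (1 - q) / r"
      using q by (subst suminf_mult) (auto simp: suminf_geometric intro!: summable_geometric)
    finally have Dsum: "norm (suminf D) \<le> K / (1 - q) / r" .
    have split: "h m / (Q ^ m * (1 + of_real r * Q ^ m)) = E0 * of_real (T m) + D m" for m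
    proof -
      have "of_real al ^ m = Q ^ m * of_real (q powr mu) ^ m"
        by (simp add: al_eq power_mult_distrib)
      thus ?thesis using q by (simp add: T_def D_def diff_divide_distrib)
    qed
    have "(\<lambda>m. E0 * of_real (T m) + D m) sums (E0 * of_real (suminf T) + suminf D)"
      using T D by (intro sums_add sums_mult summable_sums sums_of_real)
    hence eq: "- of_real r * F (- of_real r) / qpoch_inf (- of_real r) Q = E0 * of_real (suminf T) + suminf D"
      using F_minus[of r] r unfolding split by (auto intro: sums_unique2)
    \<comment> \<open>\<open>n\<close> is the least index with \<open>r * q ^ n \<le> 1\<close>; this single term already has order \<open>r powr - mu\<close>.\<close>
    define n where "n = nat \<lceil>- ln r / ln q\<rceil>"
    have lnq: "ln q < 0" using q by simp
    have quot: "- ln r / ln q \<ge> 0" using r lnq by (simp add: divide_nonneg_neg)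
    have n: "- ln r / ln q \<le> real n" "real n \<le> - ln r / ln q + 1"
      using quot unfolding n_def by linarith+
    have "real n * ln q \<le> - ln r"
      using n(1) lnq by (simp add: field_simps)
    hence "q ^ n \<le> 1 / r"
      using q r by (simp add: powr_realpow[symmetric] powr_def ln_div flip: ln_ge_iff)
    hence rq: "r * q ^ n \<le> 1" using r by (simp add: field_simps)
    \<comment> \<open>Minimality of \<open>n\<close> means \<open>q ^ n \<ge> q / r\<close>; raised
      to the power \<open>mu\<close>, this costs only the factor \<open>q powr mu\<close>.\<close>
    have "real n * ln q \<ge> - ln r + ln q"
      using n(2) lnq by (simp add: field_simps)
    hence "mu * (real n * ln q) \<ge> mu * (- ln r + ln q)"
      using mu by (intro mult_left_mono) auto
    hence "exp (mu * (real n * ln q)) \<ge> exp (mu * (- ln r + ln q))" by simp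
    also have "exp (mu * (real n * ln q)) = (q powr mu) ^ n"
      using q by (simp add: powr_def exp_of_nat_mult[symmetric] mult_ac)
    also have "exp (mu * (- ln r + ln q)) = q powr mu * r powr (- mu)"
      using q r by (simp add: powr_def exp_add[symmetric] algebra_simps)
    \<comment> \<open>The 2 bounds the denominator \<open>1 + r * q ^ n\<close>.\<close>
    finally have "q powr mu * r powr (- mu) / 2 \<le> T n"
      unfolding T_def using rq pos[of n] by (intro frac_le) auto
    also have "T n \<le> suminf T"
      using sum_le_suminf[OF T, of "{n}"] T0 by simp
    finally have Tn: "q powr mu * r powr (- mu) / 2 \<le> suminf T" .
    have T_nonneg: "suminf T \<ge> 0" using T T0 by (rule suminf_nonneg)
    have qp: "qpoch_inf (- of_real r) Q = of_real (qpoch_inf (- r) q)"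
      using qpoch_inf_of_real[of q "- r"] q by simp
    have qp0: "qpoch_inf (- r) q > 0" using q r by (intro qpoch_inf_minus_pos) auto
    have "norm E0 * (q powr mu / 2) * r powr - mu - K / (1 - q) / r \<le> norm E0 * suminf T - norm (suminf D)"
      using mult_left_mono[OF Tn, of "norm E0"] Dsum by simp
    also have "\<dots> \<le> norm (E0 * of_real (suminf T) + suminf D)"
      using norm_triangle_ineq2[of "E0 * of_real (suminf T)" "- suminf D"] T_nonneg
      by (simp add: norm_mult)
    also have "\<dots> = r * norm (F (- of_real r)) / qpoch_inf (- r) q"
      unfolding eq[symmetric] qp using r qp0 by (simp add: norm_mult norm_divide)
    finally show "norm (F (- of_real r)) \<ge> qpoch_inf (- r) q / r *
        (norm E0 * (q powr mu / 2) * r powr - mu - K / (1 - q) / r)"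
      using r qp0 by (simp add: field_simps)
  qed
qed

section \<open>From the negative axis to the maximum modulus\<close>

lemma max_modulus_F_ge: "norm z \<le> r \<Longrightarrow> norm (F z) \<le> max_modulus r F"
proof -
  assume "norm z \<le> r"
  moreover have "continuous_on (cball 0 r) (\<lambda>z. norm (F z))"
    by (intro continuous_intros holomorphic_on_imp_continuous_on
          holomorphic_on_subset[OF holomorphic_F]) auto
  \<comment> \<open>A real supremum is an upper bound only for a bounded set; compactness of the
    disc supplies this.\<close>
  hence "bdd_above ((\<lambda>z. norm (F z)) ` cball 0 r)"
    by (intro bounded_imp_bdd_above compact_imp_bounded compact_continuous_image) auto
  ultimately show ?thesis
    unfolding max_modulus_def by (intro cSUP_upper) auto
qed

text \<open>Evaluate at \<open>z = - r\<close>. Since \<open>mu < 1\<close>, the error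
  \<open>K / r\<close> is eventually at most half the main term, and \<open>1 + mu \<le> lam\<close>
  relaxes the exponent.\<close>

lemma max_modulus_F:
  assumes "1 + mu \<le> lam"
  shows "\<exists>C>0. \<forall>\<^sub>F r in at_top. max_modulus r F \<ge> C * r powr (- lam) * qpoch_inf (- r) q"
proof -
  obtain c K where cK: "c > 0" "K \<ge> 0"
    "\<And>r. r \<ge> 1 \<Longrightarrow> norm (F (- of_real r)) \<ge> qpoch_inf (- r) q / r * (c * r powr (- mu) - K / r)"
    using F_lower by blast
  have "eventually (\<lambda>r. K / r \<le> c / 2 * r powr (- mu)) at_top"
    using cK mu by real_asymp
  hence "\<forall>\<^sub>F r in at_top. max_modulus r F \<ge> c / 2 * r powr (- lam) * qpoch_inf (- r) q"
    using eventually_ge_at_top[of 1]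
  proof eventually_elim
    case (elim r)
    have qp0: "qpoch_inf (- r) q > 0" using q elim by (intro qpoch_inf_minus_pos) auto
    have "r powr (- lam) \<le> r powr (- 1 - mu)"
      using assms elim by (intro powr_mono) auto
    also have "\<dots> = r powr (- mu) / r"
      using elim by (simp add: powr_diff powr_minus field_simps)
    finally have "c / 2 * r powr (- lam) * qpoch_inf (- r) q \<le>
        c / 2 * (r powr (- mu) / r) * qpoch_inf (- r) q"
      using cK qp0 by (intro mult_right_mono mult_left_mono) auto
    also have "\<dots> = qpoch_inf (- r) q / r * (c / 2 * r powr (- mu))" by (simp add: mult_ac)
    also have "\<dots> \<le> qpoch_inf (- r) q / r * (c * r powr (- mu) - K / r)"
      using elim qp0 by (intro mult_left_mono) auto
    also have "\<dots> \<le> norm (F (- of_real r))" using cK(3) elim by auto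
    also have "\<dots> \<le> max_modulus r F" using elim by (intro max_modulus_F_ge) auto
    finally show ?case .
  qed
  thus ?thesis using cK by (intro exI[of _ "c / 2"]) auto
qed

end

theorem theorem2p8:
  fixes q lam :: real
  assumes "0 < q" and "q < 1" and "lam > 1"
  shows "\<exists>f :: real \<Rightarrow> real. continuous_on {0..1} f \<and>
           (\<exists>F :: complex \<Rightarrow> complex. F holomorphic_on UNIV \<and>
              (\<forall>x\<in>{0..1}. F (of_real x) = of_real (limit_q_Durrmeyer q f x)) \<and>
              (\<exists>C::real>0. \<forall>\<^sub>F r in at_top.
                 max_modulus r F \<ge> C * r powr (- lam) * qpoch_inf (- r) q))"
proof -
  \<comment> \<open>The cap \<open>1 / 2\<close> keeps \<open>mu\<close> below 1 for large
    \<open>lam\<close>; \<open>lam - 1\<close> ensures \<open>1 + mu \<le> lam\<close>.\<close>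
  define mu where "mu = min (lam - 1) (1 / 2)"
  interpret Durrmeyer_example q mu
    using assms by unfold_locales (auto simp: mu_def)
  have "1 + mu \<le> lam" by (simp add: mu_def)
  from max_modulus_F[OF this] continuous_f holomorphic_F F_eq_Durrmeyer show ?thesis
    by blast
qed

end
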